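(* Let $n\ge 1$ and $m\ge 2$ be integers, let $G$ be a finite region-connected $n$-simplex graph with chromatic number $\chi(G)=n+1$, and let $c:V(G)\to\{0,1,\dots,n\}$ be a proper vertex coloring of $G$. Let $L_1,L_2:V(G)\to\mathbb{Z}_m$ be labelings. Then there exists a finite sequence of pushes $f_{S_1},\dots,f_{S_t}$ (with each $S_j$ an $n$-simplex of $G$) such that $f_{S_t}\circ\cdots\circ f_{S_1}(L_1)=L_2$ if and only if $P_c[L_1]=P_c[L_2]$.
   Context: All graphs are finite simple graphs. An $n$-simplex of a graph $G$ is a set of $n+1$ vertices of $G$ that are pairwise adjacent. $G$ is an $n$-simplex graph if $G$ is a union of complete subgraphs on $n+1$ vertices (every vertex and every edge of $G$ lies in some $n$-simplex of $G$). Two $n$-simplexes $S,S'$ are adjacent if $|S\cap S'|=n$; $G$ is region-connected if for any two $n$-simplexes $S,S'$ there is a sequence $S=S_1,S_2,\dots,S_t=S'$ of $n$-simplexes with $S_j$ adjacent to $S_{j+1}$ for all $j$. A labeling is a map $L:V(G)\to\mathbb{Z}_m$. For an $n$-simplex $S$, the push $f_S$ sends a labeling $L$ to the labeling $L'$ with $L'(v)=L(v)+1 \pmod m$ for $v\in S$ and $L'(v)=L(v)$ for $v\notin S$. Let $\zeta=e^{2\pi i/m}$. For $0\le k<n$ let $i_k$ be the $n\times n$ complex diagonal matrix with $\zeta$ in diagonal position $k+1$ and $1$ in all other diagonal positions, and let $i_n=\zeta^{m-1}I_n$. For a proper coloring $c:V(G)\to\{0,\dots,n\}$ and a labeling $L$,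 define $P_c[L]=\prod_{v\in V(G)} i_{c(v)}^{\,L(v)}$ (well defined since these matrices commute and satisfy $i_k^m=I_n$). *)

theory Defs
  imports "Graph_Theory.Pair_Digraph" "Jordan_Normal_Form.Matrix" "HOL-Library.FuncSet"
    Complex_Main
begin

text \<open>
  A finite simple graph is a \<open>pair_graph\<close>: finitely many vertices and a symmetric, irreflexive
  set \<open>parcs G\<close> of ordered pairs, each edge \<open>{u, v}\<close> being represented by both \<open>(u, v)\<close>
  and \<open>(v, u)\<close>.
\<close>

definition simplexes :: "'a pair_pre_digraph \<Rightarrow> nat \<Rightarrow> 'a set set" where
  "simplexes G n =
    {S. S \<subseteq> pverts G \<and> card S = n + 1 \<and> (\<forall>u\<in>S. \<forall>v\<in>S. u \<noteq> v \<longrightarrow> (u, v) \<in> parcs G)}"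

definition simplex_graph :: "'a pair_pre_digraph \<Rightarrow> nat \<Rightarrow> bool" where
  "simplex_graph G n \<longleftrightarrow>
    (\<forall>v\<in>pverts G. \<exists>S\<in>simplexes G n. v \<in> S) \<and>
    (\<forall>(u, v)\<in>parcs G. \<exists>S\<in>simplexes G n. u \<in> S \<and> v \<in> S)"

definition adjacent_simplexes :: "nat \<Rightarrow> 'a set \<Rightarrow> 'a set \<Rightarrow> bool" where
  "adjacent_simplexes n S S' \<longleftrightarrow> card (S \<inter> S') = n"

definition region_connected :: "'a pair_pre_digraph \<Rightarrow> nat \<Rightarrow> bool" where
  "region_connected G n \<longleftrightarrow>
    (\<forall>S\<in>simplexes G n. \<forall>S'\<in>simplexes G n.
      \<exists>Ss. Ss \<noteq> [] \<and> hd Ss = S \<and> last Ss = S' \<and> set Ss \<subseteq> simplexes G n \<and>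
        successively (adjacent_simplexes n) Ss)"

definition proper_coloring :: "'a pair_pre_digraph \<Rightarrow> nat set \<Rightarrow> ('a \<Rightarrow> nat) \<Rightarrow> bool" where
  "proper_coloring G C c \<longleftrightarrow>
    c \<in> pverts G \<rightarrow> C \<and> (\<forall>(u, v)\<in>parcs G. c u \<noteq> c v)"

definition chromatic_number :: "'a pair_pre_digraph \<Rightarrow> nat" where
  "chromatic_number G = (LEAST k. \<exists>c. proper_coloring G {..<k} c)"

text \<open>
  The integers modulo \<open>m\<close> are represented by their least non-negative residues. Labelings are
  extensional, so that equality of labelings is equality on the vertices.
\<close>

definition labelings :: "'a pair_pre_digraph \<Rightarrow> nat \<Rightarrow> ('a \<Rightarrow> nat) set" where
  "labelings G m = (pverts G \<rightarrow>\<^sub>E {..<m})"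

definition push :: "nat \<Rightarrow> 'a set \<Rightarrow> ('a \<Rightarrow> nat) \<Rightarrow> ('a \<Rightarrow> nat)" where
  "push m S L = (\<lambda>v. if v \<in> S then (L v + 1) mod m else L v)"

definition zeta :: "nat \<Rightarrow> complex" where
  "zeta m = exp (2 * of_real pi * \<i> / of_nat m)"

text \<open>
  Matrix indices start at 0, so the diagonal position with entry \<open>zeta m\<close> has index \<open>k\<close>.
  Only \<open>k \<le> n\<close> matters.
\<close>

definition color_mat :: "nat \<Rightarrow> nat \<Rightarrow> nat \<Rightarrow> complex mat" where
  "color_mat n m k =
    (if k < n then mat_diag n (\<lambda>r. if r = k then zeta m else 1)
     else zeta m ^ (m - 1) \<cdot>\<^sub>m 1\<^sub>m n)"

text \<open>
  Matrices of variable size do not form a commutative monoid type, so the product over the vertex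
  set is a fold; it does not depend on the order because the factors commute
  (see \<open>label_product_enum\<close>).
\<close>

definition label_product ::
  "'a pair_pre_digraph \<Rightarrow> nat \<Rightarrow> nat \<Rightarrow> ('a \<Rightarrow> nat) \<Rightarrow> ('a \<Rightarrow> nat) \<Rightarrow> complex mat" where
  "label_product G n m c L =
    Finite_Set.fold (\<lambda>v M. (color_mat n m (c v) ^\<^sub>m L v) * M) (1\<^sub>m n) (pverts G)"

lemma mat_diag_pow: "mat_diag n f ^\<^sub>m k = mat_diag n (\<lambda>r. f r ^ k)"
proof (induction k)
  case 0
  have "dim_row (mat_diag n f) = n" by (simp add: mat_diag_def)
  then show ?case by simp
next
  case (Suc k)
  then show ?case by (simp add: power_Suc2 del: power_Suc)
qed

definition color_entry :: "nat \<Rightarrow> nat \<Rightarrow> nat \<Rightarrow> nat \<Rightarrow> complex" where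
  "color_entry n m k r =
    (if k < n then (if r = k then zeta m else 1) else zeta m ^ (m - 1))"

lemma color_mat_eq: "color_mat n m k = mat_diag n (color_entry n m k)"
proof (cases "k < n")
  case True
  then have "color_entry n m k = (\<lambda>r. if r = k then zeta m else 1)"
    by (simp add: color_entry_def fun_eq_iff)
  with True show ?thesis by (simp add: color_mat_def)
next
  case False
  then show ?thesis
    by (intro eq_matI) (simp_all add: color_mat_def color_entry_def mat_diag_def)
qed

lemma zeta_pow: "m > 0 \<Longrightarrow> zeta m ^ m = 1"
  by (simp add: zeta_def flip: exp_of_nat_mult)

lemma color_mat_pow:
  assumes "m > 0"
  shows "color_mat n m k ^\<^sub>m m = 1\<^sub>m n"
proof -
  have "(zeta m ^ (m - 1)) ^ m = (zeta m ^ m) ^ (m - 1)"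
    by (simp only: power_mult [symmetric] mult.commute)
  then have "color_entry n m k r ^ m = 1" for r
    using zeta_pow[OF assms] by (simp add: color_entry_def)
  then show ?thesis
    by (simp add: color_mat_eq mat_diag_pow)
qed

lemma label_product_eq:
  assumes "finite (pverts G)"
  shows "label_product G n m c L =
    mat_diag n (\<lambda>r. \<Prod>v\<in>pverts G. color_entry n m (c v) r ^ L v)"
proof -
  let ?f = "\<lambda>v M. (color_mat n m (c v) ^\<^sub>m L v) * M"
  let ?d = "\<lambda>A. mat_diag n (\<lambda>r. \<Prod>v\<in>A. color_entry n m (c v) r ^ L v)"
  have *: "finite A \<and> y = ?d A" if "fold_graph ?f (1\<^sub>m n) A y" for A y
    using that
  proof (induction rule: fold_graph.induct)
    case emptyI
    show ?case by simp
  next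
    case (insertI x A y)
    then show ?case by (simp add: color_mat_eq mat_diag_pow)
  qed
  obtain y where y: "fold_graph ?f (1\<^sub>m n) (pverts G) y"
    by (rule exE[OF finite_imp_fold_graph[OF assms, of ?f "1\<^sub>m n"]])
  have "(THE y. fold_graph ?f (1\<^sub>m n) (pverts G) y) = y"
  proof (rule the_equality)
    show "z = y" if "fold_graph ?f (1\<^sub>m n) (pverts G) z" for z
      using *[OF that] *[OF y] by simp
  qed (rule y)
  also have "y = ?d (pverts G)"
    using *[OF y] by (rule conjunct2)
  finally show ?thesis
    unfolding label_product_def Finite_Set.fold_def if_P[OF assms] .
qed

lemma label_product_enum:
  assumes "set vs = pverts G" "distinct vs"
  shows "label_product G n m c L =
    foldr (\<lambda>v M. (color_mat n m (c v) ^\<^sub>m L v) * M) vs (1\<^sub>m n)"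
proof -
  have "foldr (\<lambda>v M. (color_mat n m (c v) ^\<^sub>m L v) * M) us (1\<^sub>m n) =
    mat_diag n (\<lambda>r. \<Prod>v\<in>set us. color_entry n m (c v) r ^ L v)"
    if "distinct us" for us
    using that by (induction us) (simp_all add: color_mat_eq mat_diag_pow)
  note enum = this[OF assms(2)]
  have "finite (pverts G)"
    unfolding assms(1) [symmetric] by (rule finite_set)
  then show ?thesis
    unfolding enum assms(1) by (rule label_product_eq)
qed

end

theory Submission
  imports Defs "HOL-Number_Theory.Cong"
begin

text \<open>
  Comparing diagonal entries, equality of the two matrix products says that for \<open>x = L\<^sub>2 - L\<^sub>1\<close> the
  sums of \<open>x\<close> over all color classes agree modulo \<open>m\<close>. Every simplex meets each color class
  exactly once, so pushes preserve this. Conversely, pushing \<open>S\<close> and unpushing an adjacent \<open>S'\<close>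
  (that is, pushing it \<open>m - 1\<close> times) changes only the two vertices in which they differ, which have
  the same color; along a chain of simplexes this moves a unit of label between any two vertices of
  the same color. So \<open>x\<close> can be concentrated on one simplex, where it becomes constant and is a
  multiple of a single push.
\<close>

section \<open>Integer functions realised by pushes\<close>

definition push_count :: "'a set list \<Rightarrow> 'a \<Rightarrow> int" where
  "push_count Ss v = (\<Sum>S\<leftarrow>Ss. of_bool (v \<in> S))"

text \<open>This is the subgroup generated by the indicator functions of members of
  \<open>F\<close>, modulo \<open>m\<close>. Lists rather than coefficient functions are used
  because they are the push sequences of the theorem. The congruence is imposed at every
  \<open>v\<close>, not only at vertices.\<close>

definition push_span :: "nat \<Rightarrow> 'a set set \<Rightarrow> ('a \<Rightarrow> int) set" where
  "push_span m F = {x. \<exists>Ss. set Ss \<subseteq> F \<and> (\<forall>v. [x v = push_count Ss v] (mod int m))}"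

lemma push_count_simps [simp]:
  "push_count [] v = 0"
  "push_count (S # Ss) v = of_bool (v \<in> S) + push_count Ss v"
  "push_count (Ss @ Ts) v = push_count Ss v + push_count Ts v"
  by (simp_all add: push_count_def)

section \<open>Closure under integer linear combinations\<close>

lemma push_span_cong:
  assumes "x \<in> push_span m F" and "\<And>v. [y v = x v] (mod int m)"
  shows "y \<in> push_span m F"
  using assms unfolding push_span_def by (blast intro: cong_trans)

lemma push_span_zero: "(\<lambda>v. 0) \<in> push_span m F"
  unfolding push_span_def by (auto intro: exI[of _ "[]"])

lemma push_span_simplex: "S \<in> F \<Longrightarrow> (\<lambda>v. of_bool (v \<in> S)) \<in> push_span m F"
  unfolding push_span_def by (auto intro: exI[of _ "[S]"])

lemma push_span_add:
  assumes "x \<in> push_span m F" "y \<in> push_span m F"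
  shows "(\<lambda>v. x v + y v) \<in> push_span m F"
proof -
  from assms obtain Ss Ts where
    "set Ss \<subseteq> F" "\<And>v. [x v = push_count Ss v] (mod int m)"
    "set Ts \<subseteq> F" "\<And>v. [y v = push_count Ts v] (mod int m)"
    unfolding push_span_def by blast
  then show ?thesis
    unfolding push_span_def by (auto intro!: exI[of _ "Ss @ Ts"] cong_add)
qed

lemma push_span_scale_nat:
  assumes "x \<in> push_span m F"
  shows "(\<lambda>v. int k * x v) \<in> push_span m F"
proof (induction k)
  case 0
  show ?case by (simp add: push_span_zero)
next
  case (Suc k)
  show ?case
    using push_span_add[OF assms Suc.IH] by (simp add: algebra_simps)
qed

text \<open>Negative coefficients are replaced by their residues modulo \<open>m\<close>. This
  supplies inverses, although pushes only add.\<close>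

lemma push_span_scale:
  assumes "m > 0" "x \<in> push_span m F"
  shows "(\<lambda>v. a * x v) \<in> push_span m F"
proof (rule push_span_cong)
  show "(\<lambda>v. int (nat (a mod int m)) * x v) \<in> push_span m F"
    by (rule push_span_scale_nat[OF assms(2)])
  show "[a * x v = int (nat (a mod int m)) * x v] (mod int m)" for v
    using assms(1) by (intro cong_scalar_right) simp
qed

lemma push_span_diff:
  assumes "m > 0" "x \<in> push_span m F" "y \<in> push_span m F"
  shows "(\<lambda>v. x v - y v) \<in> push_span m F"
  using push_span_add[OF assms(2) push_span_scale[OF assms(1,3), of "-1"]] by simp

lemma push_span_sum:
  assumes "finite A" "\<And>a. a \<in> A \<Longrightarrow> f a \<in> push_span m F"
  shows "(\<lambda>v. \<Sum>a\<in>A. f a v) \<in> push_span m F"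
  using assms by (induction A rule: finite_induct) (simp_all add: push_span_zero push_span_add)

section \<open>Push sequences acting on labelings\<close>

lemma fold_push_cong:
  "[int (fold (push m) Ss L v) = int (L v) + push_count Ss v] (mod int m)"
proof (induction Ss arbitrary: L)
  case Nil
  show ?case by simp
next
  case (Cons S Ss)
  have "[int (push m S L v) = int (L v) + of_bool (v \<in> S)] (mod int m)"
    by (simp add: push_def zmod_int cong_def mod_simps ac_simps)
  from cong_add[OF this cong_refl[of "push_count Ss v"]] show ?case
    using Cons.IH[of "push m S L"] by (auto simp: ac_simps intro: cong_trans)
qed

lemma fold_push_labelings:
  assumes "m > 0" "L \<in> labelings G m" "\<forall>S\<in>set Ss. S \<subseteq> pverts G"
  shows "fold (push m) Ss L \<in> labelings G m"
  using assms(2,3)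
proof (induction Ss arbitrary: L)
  case (Cons S Ss)
  have "push m S L \<in> labelings G m"
    using Cons.prems assms(1) by (auto simp: labelings_def push_def PiE_iff extensional_def)
  then show ?case using Cons by simp
qed simp

lemma labelings_eqI:
  assumes "L \<in> labelings G m" "L' \<in> labelings G m"
    and "\<And>v. v \<in> pverts G \<Longrightarrow> [int (L v) = int (L' v)] (mod int m)"
  shows "L = L'"
proof (rule PiE_ext)
  show "L \<in> pverts G \<rightarrow>\<^sub>E {..<m}" "L' \<in> pverts G \<rightarrow>\<^sub>E {..<m}"
    using assms by (simp_all add: labelings_def)
  show "L v = L' v" if "v \<in> pverts G" for v
    using assms that
    by (auto simp: labelings_def PiE_iff cong_int_iff dest: cong_less_modulus_unique_nat)
qed

text \<open>Up to congruence a push sequence just adds its \<open>push_count\<close>, whatever its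
  order. Labels are least residues and labelings are extensional, so congruence at the vertices is
  already equality.\<close>

lemma pushes_exist_iff:
  assumes "m > 0" "L\<^sub>1 \<in> labelings G m" "L\<^sub>2 \<in> labelings G m"
    and F: "\<And>S. S \<in> F \<Longrightarrow> S \<subseteq> pverts G"
  shows "(\<exists>Ss. set Ss \<subseteq> F \<and> fold (push m) Ss L\<^sub>1 = L\<^sub>2) \<longleftrightarrow>
    (\<lambda>v. int (L\<^sub>2 v) - int (L\<^sub>1 v)) \<in> push_span m F"
proof -
  have "fold (push m) Ss L\<^sub>1 = L\<^sub>2 \<longleftrightarrow>
      (\<forall>v. [int (L\<^sub>2 v) - int (L\<^sub>1 v) = push_count Ss v] (mod int m))"
    if "set Ss \<subseteq> F" for Ss
  proof
    assume "fold (push m) Ss L\<^sub>1 = L\<^sub>2"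
    then show "\<forall>v. [int (L\<^sub>2 v) - int (L\<^sub>1 v) = push_count Ss v] (mod int m)"
      using fold_push_cong[of m Ss L\<^sub>1] by (auto simp: cong_iff_dvd_diff algebra_simps)
  next
    assume *: "\<forall>v. [int (L\<^sub>2 v) - int (L\<^sub>1 v) = push_count Ss v] (mod int m)"
    show "fold (push m) Ss L\<^sub>1 = L\<^sub>2"
    proof (rule labelings_eqI)
      show "fold (push m) Ss L\<^sub>1 \<in> labelings G m"
        using assms that by (intro fold_push_labelings) auto
      show "[int (fold (push m) Ss L\<^sub>1 v) = int (L\<^sub>2 v)] (mod int m)" for v
      proof -
        have "[int (L\<^sub>1 v) + push_count Ss v = int (L\<^sub>1 v) + (int (L\<^sub>2 v) - int (L\<^sub>1 v))] (mod int m)"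
          using * by (intro cong_add cong_refl) (simp add: cong_sym)
        with fold_push_cong[of m Ss L\<^sub>1 v] show ?thesis
          by (auto intro: cong_trans)
      qed
    qed (rule assms)
  qed
  then show ?thesis
    unfolding push_span_def by blast
qed

section \<open>The matrix product in terms of color classes\<close>

definition color_sum :: "'a pair_pre_digraph \<Rightarrow> ('a \<Rightarrow> nat) \<Rightarrow> nat \<Rightarrow> ('a \<Rightarrow> int) \<Rightarrow> int" where
  "color_sum G c k x = (\<Sum>v | v \<in> pverts G \<and> c v = k. x v)"

text \<open>\<open>zeta m\<close> is a primitive \<open>m\<close>-th root of unity: the residues
  below \<open>m\<close> index the roots of unity injectively.\<close>

lemma zeta_power_eq_iff:
  assumes "m > 0"
  shows "zeta m ^ a = zeta m ^ b \<longleftrightarrow> [a = b] (mod m)"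
proof -
  have zeta_cis: "zeta m ^ k = cis (2 * pi * real (k mod m) / real m)" for k
  proof -
    have "zeta m ^ k = zeta m ^ (m * (k div m) + k mod m)" by simp
    also have "\<dots> = zeta m ^ (k mod m)"
      by (simp only: power_add power_mult zeta_pow[OF assms] power_one mult_1)
    also have "\<dots> = cis (2 * pi / real m) ^ (k mod m)"
      by (simp add: zeta_def cis_conv_exp ac_simps)
    also have "\<dots> = cis (2 * pi * real (k mod m) / real m)"
      by (simp add: DeMoivre ac_simps)
    finally show ?thesis .
  qed
  have "inj_on (\<lambda>k. cis (2 * pi * real k / real m)) {..<m}"
    using bij_betw_roots_unity[OF assms] by (rule bij_betw_imp_inj_on)
  then show ?thesis
    unfolding zeta_cis cong_def by (subst inj_on_eq_iff) (use assms in auto)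
qed

lemma color_sum_int:
  "color_sum G c k (\<lambda>v. int (L v)) = int (\<Sum>v | v \<in> pverts G \<and> c v = k. L v)"
  by (simp add: color_sum_def)

lemma color_sum_diff:
  "color_sum G c k (\<lambda>v. x v - y v) = color_sum G c k x - color_sum G c k y"
  by (simp add: color_sum_def sum_subtractf)

text \<open>At diagonal position \<open>r\<close> only the matrices of colors \<open>r\<close> and
  \<open>n\<close> differ from 1; the latter contributes the exponent \<open>m - 1\<close>.\<close>

lemma prod_color_entry:
  assumes fin: "finite (pverts G)" and c: "c \<in> pverts G \<rightarrow> {0..n}" and r: "r < n"
  shows "(\<Prod>v\<in>pverts G. color_entry n m (c v) r ^ L v) =
    zeta m ^ ((\<Sum>v | v \<in> pverts G \<and> c v = r. L v) +
      (m - 1) * (\<Sum>v | v \<in> pverts G \<and> c v = n. L v))"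
proof -
  have "(\<Prod>v\<in>pverts G. color_entry n m (c v) r ^ L v) =
      (\<Prod>v\<in>pverts G. zeta m ^ ((if c v = r then L v else 0) + (m - 1) * (if c v = n then L v else 0)))"
  proof (rule prod.cong[OF refl])
    fix v assume "v \<in> pverts G"
    then have "c v \<le> n" using c by auto
    then show "color_entry n m (c v) r ^ L v =
        zeta m ^ ((if c v = r then L v else 0) + (m - 1) * (if c v = n then L v else 0))"
      using r by (auto simp: color_entry_def power_mult)
  qed
  also have "\<dots> = zeta m ^ (\<Sum>v\<in>pverts G. (if c v = r then L v else 0) + (m - 1) * (if c v = n then L v else 0))"
    by (simp add: power_sum)
  also have "(\<Sum>v\<in>pverts G. (if c v = r then L v else 0) + (m - 1) * (if c v = n then L v else 0)) =
      (\<Sum>v | v \<in> pverts G \<and> c v = r. L v) + (m - 1) * (\<Sum>v | v \<in> pverts G \<and> c v = n. L v)"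
    using fin by (simp add: sum.distrib sum.inter_filter flip: sum_distrib_left)
  finally show ?thesis .
qed

text \<open>Since \<open>m - 1\<close> is -1 modulo \<open>m\<close>, entry \<open>r\<close> records
  the label sum of class \<open>r\<close> minus that of class \<open>n\<close>, as an exponent of
  \<open>zeta m\<close>.\<close>

lemma label_product_eq_iff:
  fixes L\<^sub>1 L\<^sub>2 :: "'a \<Rightarrow> nat"
  assumes fin: "finite (pverts G)" and c: "c \<in> pverts G \<rightarrow> {0..n}" and m: "m > 0"
  defines "x \<equiv> \<lambda>v. int (L\<^sub>2 v) - int (L\<^sub>1 v)"
  shows "label_product G n m c L\<^sub>1 = label_product G n m c L\<^sub>2 \<longleftrightarrow>
    (\<forall>r<n. [color_sum G c r x = color_sum G c n x] (mod int m))"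
proof -
  have diag: "mat_diag n f = mat_diag n g \<longleftrightarrow> (\<forall>r<n. f r = g r)" for f g :: "nat \<Rightarrow> complex"
  proof
    assume eq: "mat_diag n f = mat_diag n g"
    have "mat_diag n h $$ (r, r) = h r" if "r < n" for h :: "nat \<Rightarrow> complex" and r
      using that by (simp add: mat_diag_def)
    with eq show "\<forall>r<n. f r = g r" by metis
  qed (auto simp: mat_diag_def intro!: eq_matI)
  define s where "s L k = (\<Sum>v | v \<in> pverts G \<and> c v = k. L v)" for L :: "'a \<Rightarrow> nat" and k
  have "label_product G n m c L\<^sub>1 = label_product G n m c L\<^sub>2 \<longleftrightarrow>
      (\<forall>r<n. [s L\<^sub>1 r + (m - 1) * s L\<^sub>1 n = s L\<^sub>2 r + (m - 1) * s L\<^sub>2 n] (mod m))"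
    unfolding label_product_eq[OF fin] diag
    by (simp add: prod_color_entry[OF fin c] zeta_power_eq_iff[OF m] s_def)
  also have "\<dots> \<longleftrightarrow> (\<forall>r<n. [color_sum G c r x = color_sum G c n x] (mod int m))"
  proof (intro all_cong1 imp_cong refl)
    fix r
    let ?d = "int (s L\<^sub>2 r) - int (s L\<^sub>1 r) - (int (s L\<^sub>2 n) - int (s L\<^sub>1 n))"
    have "[s L\<^sub>1 r + (m - 1) * s L\<^sub>1 n = s L\<^sub>2 r + (m - 1) * s L\<^sub>2 n] (mod m) \<longleftrightarrow>
        int m dvd int (s L\<^sub>1 r + (m - 1) * s L\<^sub>1 n) - int (s L\<^sub>2 r + (m - 1) * s L\<^sub>2 n)"
      by (simp only: cong_iff_dvd_diff flip: cong_int_iff)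
    \<comment> \<open>Splitting \<open>m - 1\<close> isolates a multiple of \<open>m\<close>, which
      drops out of the divisibility.\<close>
    also have "int (s L\<^sub>1 r + (m - 1) * s L\<^sub>1 n) - int (s L\<^sub>2 r + (m - 1) * s L\<^sub>2 n) =
        int m * (int (s L\<^sub>1 n) - int (s L\<^sub>2 n)) - ?d"
      using m by (simp add: left_diff_distrib right_diff_distrib of_nat_diff Suc_le_eq)
    also have "int m dvd \<dots> \<longleftrightarrow> int m dvd ?d"
      by (simp add: dvd_diff_right_iff)
    also have "\<dots> \<longleftrightarrow> [color_sum G c r x = color_sum G c n x] (mod int m)"
      by (simp add: x_def color_sum_diff color_sum_int s_def cong_iff_dvd_diff)
    finally show "[s L\<^sub>1 r + (m - 1) * s L\<^sub>1 n = s L\<^sub>2 r + (m - 1) * s L\<^sub>2 n] (mod m) \<longleftrightarrow>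
        [color_sum G c r x = color_sum G c n x] (mod int m)" .
  qed
  finally show ?thesis .
qed

section \<open>Colored simplexes\<close>

lemma simplex_subset: "S \<in> simplexes G n \<Longrightarrow> S \<subseteq> pverts G"
  by (simp add: simplexes_def)

text \<open>Pairwise adjacent vertices have distinct colors, and there are as many vertices in
  \<open>S\<close> as colors.\<close>

lemma simplex_color_bij:
  assumes c: "proper_coloring G {0..n} c" and S: "S \<in> simplexes G n"
  shows "bij_betw c S {0..n}"
proof -
  have "inj_on c S"
    using assms by (fastforce simp: inj_on_def proper_coloring_def simplexes_def)
  moreover have "c ` S \<subseteq> {0..n}"
    using assms by (auto simp: proper_coloring_def simplexes_def)
  moreover have "card (c ` S) = card {0..n}"
    using S \<open>inj_on c S\<close> by (simp add: simplexes_def card_image)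
  ultimately show ?thesis
    by (simp add: bij_betw_def card_subset_eq)
qed

lemma color_sum_simplex:
  assumes c: "proper_coloring G {0..n} c" and S: "S \<in> simplexes G n"
    and fin: "finite (pverts G)" and k: "k \<le> n"
  shows "color_sum G c k (\<lambda>v. of_bool (v \<in> S)) = 1"
proof -
  obtain p where p: "p \<in> S" "c p = k"
    using simplex_color_bij[OF c S] k by (auto simp: bij_betw_def dest!: equalityD2)
  then have "{v. (v \<in> pverts G \<and> c v = k) \<and> v \<in> S} = {p}"
    using simplex_color_bij[OF c S] simplex_subset[OF S] by (auto simp: bij_betw_def inj_on_def)
  then show ?thesis
    using fin by (simp add: color_sum_def sum.inter_filter[symmetric] of_bool_def Collect_conj_eq)
qed

text \<open>Each push raises every color sum by 1, so all of them are congruent to the number of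
  pushes.\<close>

lemma push_span_color_sum:
  assumes c: "proper_coloring G {0..n} c" and fin: "finite (pverts G)"
    and x: "x \<in> push_span m (simplexes G n)" and "k \<le> n" "l \<le> n"
  shows "[color_sum G c k x = color_sum G c l x] (mod int m)"
proof -
  obtain Ss where Ss: "set Ss \<subseteq> simplexes G n" "\<And>v. [x v = push_count Ss v] (mod int m)"
    using x unfolding push_span_def by blast
  have *: "color_sum G c j (push_count Ss) = int (length Ss)" if "j \<le> n" for j
    using Ss(1)
  proof (induction Ss)
    case (Cons S Ss)
    then have "color_sum G c j (push_count (S # Ss)) =
        color_sum G c j (\<lambda>v. of_bool (v \<in> S)) + color_sum G c j (push_count Ss)"
      by (simp add: color_sum_def sum.distrib)
    with Cons show ?case
      using color_sum_simplex[OF c _ fin that] by (simp del: push_count_simps)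
  qed (simp add: color_sum_def)
  have "[color_sum G c j x = int (length Ss)] (mod int m)" if "j \<le> n" for j
    unfolding *[OF that, symmetric] color_sum_def using Ss(2) by (intro cong_sum)
  with assms(4,5) show ?thesis
    by (meson cong_sym cong_trans)
qed

section \<open>Moving labels within a color class\<close>

lemma adjacent_simplexes_transfer:
  assumes c: "proper_coloring G {0..n} c" and m: "m > 0"
    and S: "S \<in> simplexes G n" and T: "T \<in> simplexes G n" and adj: "adjacent_simplexes n S T"
    and "u \<in> S" "w \<in> T" "c u = c w"
  shows "(\<lambda>v. of_bool (v = u) - of_bool (v = w)) \<in> push_span m (simplexes G n)"
proof (cases "u = w")
  case True
  then show ?thesis by (simp add: push_span_zero)
next
  case False
  have fin: "finite S" "finite T" and card: "card S = n + 1" "card T = n + 1"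
    using S T by (auto simp: simplexes_def intro: card_ge_0_finite)
  \<comment> \<open>Otherwise \<open>u\<close> and \<open>w\<close> would be two vertices of the
    same color in one simplex.\<close>
  have "u \<notin> T" "w \<notin> S"
    using simplex_color_bij[OF c S] simplex_color_bij[OF c T] False assms(6-8)
    by (auto simp: bij_betw_def inj_on_def)
  moreover have "card (S - T) = 1" "card (T - S) = 1"
    using adj card fin
    by (simp_all add: adjacent_simplexes_def card_Diff_subset_Int Int_commute)
  ultimately have "S - T = {u}" "T - S = {w}"
    using assms(6,7) by (metis DiffI card_1_singletonE singletonD)+
  then have "(\<lambda>v. of_bool (v = u) - of_bool (v = w)) = (\<lambda>v. of_bool (v \<in> S) - of_bool (v \<in> T) :: int)"
    by (auto simp: fun_eq_iff of_bool_def)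
  also have "\<dots> \<in> push_span m (simplexes G n)"
    by (intro push_span_diff push_span_simplex m S T)
  finally show ?thesis .
qed

text \<open>The transfers between consecutive simplexes telescope, passing through the vertex of the
  given color in each.\<close>

lemma simplex_chain_transfer:
  assumes c: "proper_coloring G {0..n} c" and m: "m > 0"
    and "Ss \<noteq> []" "set Ss \<subseteq> simplexes G n" "successively (adjacent_simplexes n) Ss"
    and "u \<in> hd Ss" "w \<in> last Ss" "c u = c w"
  shows "(\<lambda>v. of_bool (v = u) - of_bool (v = w)) \<in> push_span m (simplexes G n)"
  using assms(3-)
proof (induction Ss arbitrary: u)
  case (Cons S Ss)
  show ?case
  proof (cases "Ss = []")
    case True
    with Cons.prems have "u = w"
      using simplex_color_bij[OF c, of S] by (auto simp: bij_betw_def inj_on_def)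
    then show ?thesis by (simp add: push_span_zero)
  next
    case False
    have S: "S \<in> simplexes G n" and T: "hd Ss \<in> simplexes G n"
      and adj: "adjacent_simplexes n S (hd Ss)"
      using Cons.prems False by (auto simp: successively_Cons)
    have "c u \<in> {0..n}"
      using bij_betwE[OF simplex_color_bij[OF c S]] Cons.prems(4) by simp
    then obtain p where p: "p \<in> hd Ss" "c p = c u"
      using simplex_color_bij[OF c T] by (metis bij_betw_def imageE)
    have "(\<lambda>v. of_bool (v = u) - of_bool (v = p)) \<in> push_span m (simplexes G n)"
      using Cons.prems p by (intro adjacent_simplexes_transfer[OF c m S T adj]) auto
    moreover have "(\<lambda>v. of_bool (v = p) - of_bool (v = w)) \<in> push_span m (simplexes G n)"
      using Cons.prems False p by (intro Cons.IH) (auto simp: successively_Cons)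
    ultimately show ?thesis
      using push_span_add by fastforce
  qed
qed simp

lemma push_spanI_color_sum:
  assumes c: "proper_coloring G {0..n} c" and m: "m > 0" and fin: "finite (pverts G)"
    and G: "simplex_graph G n" "region_connected G n"
    and supp: "\<And>v. v \<notin> pverts G \<Longrightarrow> x v = 0"
    and x: "\<And>r. r < n \<Longrightarrow> [color_sum G c r x = color_sum G c n x] (mod int m)"
  shows "x \<in> push_span m (simplexes G n)"
proof (cases "pverts G = {}")
  case True
  \<comment> \<open>Here there is no simplex on which to collect labels.\<close>
  with supp have "x = (\<lambda>v. 0)" by auto
  then show ?thesis by (simp add: push_span_zero)
next
  case False
  then obtain S where S: "S \<in> simplexes G n"
    using G(1) by (auto simp: simplex_graph_def)
  note bij = simplex_color_bij[OF c S]
  \<comment> \<open>\<open>p u\<close> is the vertex of the fixed simplex \<open>S\<close> that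
    shares the color of \<open>u\<close>.\<close>
  define p where "p u = inv_into S c (c u)" for u
  have cV: "c u \<in> c ` S" if "u \<in> pverts G" for u
    using c that bij by (auto simp: proper_coloring_def bij_betw_def)
  have p: "p u \<in> S" "c (p u) = c u" if "u \<in> pverts G" for u
    using cV[OF that] by (auto simp: p_def inv_into_into f_inv_into_f)
  have p_eq: "v = p u \<longleftrightarrow> v \<in> S \<and> c v = c u" if "u \<in> pverts G" for u v
    using p[OF that] bij by (auto simp: bij_betw_def inj_on_def)
  \<comment> \<open>\<open>y\<close> sums the transfers of \<open>x u\<close> units between
    \<open>u\<close> and \<open>p u\<close>, so \<open>x - y\<close> is supported on
    \<open>S\<close>.\<close>
  define y where "y v = (\<Sum>u\<in>pverts G. x u * (of_bool (v = u) - of_bool (v = p u)))" for v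
  have "y \<in> push_span m (simplexes G n)"
    unfolding y_def
  proof (intro push_span_sum push_span_scale m fin)
    fix u assume u: "u \<in> pverts G"
    then obtain T where T: "T \<in> simplexes G n" "u \<in> T"
      using G(1) by (auto simp: simplex_graph_def)
    then obtain Ss where "Ss \<noteq> []" "hd Ss = T" "last Ss = S" "set Ss \<subseteq> simplexes G n"
        "successively (adjacent_simplexes n) Ss"
      using G(2) S unfolding region_connected_def by blast
    then show "(\<lambda>v. of_bool (v = u) - of_bool (v = p u)) \<in> push_span m (simplexes G n)"
      using T p[OF u] by (intro simplex_chain_transfer[OF c m, of Ss]) auto
  qed
  \<comment> \<open>The remainder \<open>x - y\<close> has at each vertex of \<open>S\<close> the
    full sum of its color class. By hypothesis all these sums are congruent to that of color
    \<open>n\<close>, so a multiple of one simplex accounts for them.\<close>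
  moreover have "(\<lambda>v. color_sum G c n x * of_bool (v \<in> S)) \<in> push_span m (simplexes G n)"
    by (intro push_span_scale push_span_simplex m S)
  ultimately have "(\<lambda>v. y v + color_sum G c n x * of_bool (v \<in> S)) \<in> push_span m (simplexes G n)"
    by (rule push_span_add)
  then show ?thesis
  proof (rule push_span_cong)
    fix v
    \<comment> \<open>For \<open>v\<close> outside the graph the sum is empty of matches, and
      \<open>supp\<close> gives 0 on the right.\<close>
    have "(\<Sum>u\<in>pverts G. x u * of_bool (v = u)) = x v"
      using fin supp[of v] by (simp add: of_bool_def if_distrib[of "\<lambda>b. _ * b"] sum.delta' cong: if_cong)
    moreover have "(\<Sum>u\<in>pverts G. x u * of_bool (v = p u)) = color_sum G c (c v) x * of_bool (v \<in> S)"
    proof -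
      have "(\<Sum>u\<in>pverts G. x u * of_bool (v = p u)) =
          (\<Sum>u\<in>pverts G. (if c u = c v then x u else 0) * of_bool (v \<in> S))"
        by (rule sum.cong) (auto simp: p_eq)
      also have "\<dots> = color_sum G c (c v) x * of_bool (v \<in> S)"
        unfolding color_sum_def using fin by (simp add: sum.inter_filter flip: sum_distrib_right)
      finally show ?thesis .
    qed
    ultimately have y: "y v = x v - color_sum G c (c v) x * of_bool (v \<in> S)"
      by (simp add: y_def right_diff_distrib sum_subtractf)
    have "[color_sum G c (c v) x * of_bool (v \<in> S) = color_sum G c n x * of_bool (v \<in> S)] (mod int m)"
    proof (cases "v \<in> S")
      case True
      then have "c v \<le> n" using bij by (auto simp: bij_betw_def)
      then show ?thesis using x[of "c v"] True by (cases "c v = n") auto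
    qed simp
    then show "[x v = y v + color_sum G c n x * of_bool (v \<in> S)] (mod int m)"
      by (simp add: y cong_iff_dvd_diff)
  qed
qed

theorem theorem4p5p1:
  fixes G :: "'a pair_pre_digraph" and n m :: nat and c L\<^sub>1 L\<^sub>2 :: "'a \<Rightarrow> nat"
  assumes "n \<ge> 1" and "m \<ge> 2"
    and "pair_graph G"
    and "simplex_graph G n"
    and "region_connected G n"
    and "chromatic_number G = n + 1"
    and "proper_coloring G {0..n} c"
    and "L\<^sub>1 \<in> labelings G m" and "L\<^sub>2 \<in> labelings G m"
  shows "(\<exists>Ss. set Ss \<subseteq> simplexes G n \<and> fold (push m) Ss L\<^sub>1 = L\<^sub>2) \<longleftrightarrow>
    label_product G n m c L\<^sub>1 = label_product G n m c L\<^sub>2"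
proof -
  let ?x = "\<lambda>v. int (L\<^sub>2 v) - int (L\<^sub>1 v)"
  interpret pair_graph G by (rule assms)
  have fin: "finite (pverts G)" by (rule pair_finite_verts)
  have m: "m > 0" using assms by simp
  \<comment> \<open>Off the vertices both labelings equal \<open>undefined\<close>, so the
    difference cancels.\<close>
  have supp: "?x v = 0" if "v \<notin> pverts G" for v
    using assms(8,9) that by (simp add: labelings_def PiE_iff extensional_def)
  have "(\<exists>Ss. set Ss \<subseteq> simplexes G n \<and> fold (push m) Ss L\<^sub>1 = L\<^sub>2) \<longleftrightarrow>
      ?x \<in> push_span m (simplexes G n)"
    by (rule pushes_exist_iff[OF m assms(8,9) simplex_subset])
  also have "\<dots> \<longleftrightarrow> (\<forall>r<n. [color_sum G c r ?x = color_sum G c n ?x] (mod int m))"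
    by (auto intro: push_span_color_sum[OF assms(7) fin]
        push_spanI_color_sum[OF assms(7) m fin assms(4,5) supp])
  also have "\<dots> \<longleftrightarrow> label_product G n m c L\<^sub>1 = label_product G n m c L\<^sub>2"
    using assms(7) by (intro label_product_eq_iff[symmetric] fin m) (simp add: proper_coloring_def)
  finally show ?thesis .
qed

end
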